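(* For all integers $m,n\ge1$ and all $\lambda\in\mathbb{C}$ with $\lambda\neq0$ and $\lambda^m\neq1$, \[ H_{n-1}^{(n)}(x|\lambda)=\left(\frac{1-\lambda}{1-\lambda^m}\right)^n\lambda^{mn}\sum_{s=0}^{n-1}\sum_{k=0}^{s}\binom{s}{k}\binom{n-1}{s}(-n)^{s-k}m^{n-1-s}\,S_k^{(n)}(m|\lambda)\,H_{n-1-s}^{(n)}\!\left(\frac{x}{m}\,\middle|\,\lambda^m\right). \]
   Context: For $\mu\in\mathbb{C}$, $\mu\neq1$, the higher-order Frobenius–Euler polynomials are defined by $\left(\frac{1-\mu}{e^t-\mu}\right)^{n}e^{xt}=\sum_{j\ge0}H_j^{(n)}(x|\mu)\frac{t^j}{j!}$. For integers $n\ge0$, $m\ge1$, $k\ge0$ and $\lambda\ne0$, the $\lambda$-analogue of the multiple power sum is \[S_k^{(n)}(m|\lambda)=\sum_{\substack{0\le v_1,\dots,v_m\le n\\ v_1+\cdots+v_m=n}}\binom{n}{v_1,\dots,v_m}\lambda^{-(v_1+2v_2+\cdots+mv_m)}(v_1+2v_2+\cdots+mv_m)^k,\] with $\binom{n}{v_1,\dots,v_m}$ the multinomial coefficient. *)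

theory Defs
  imports
    Complex_Main
    "HOL-Library.FuncSet"
    "HOL-Computational_Algebra.Formal_Power_Series"
begin

(* For \<mu> \<noteq> 1 the denominator has the nonzero constant term 1 - \<mu>, so the quotient is the
   genuine quotient of power series in t; for \<mu> = 1 the value is not meaningful. *)
definition frobenius_euler_fps :: "nat \<Rightarrow> complex \<Rightarrow> complex \<Rightarrow> complex fps" where
  "frobenius_euler_fps n x \<mu> =
     (fps_const (1 - \<mu>) / (fps_exp 1 - fps_const \<mu>)) ^ n * fps_exp x"

definition frobenius_euler :: "nat \<Rightarrow> nat \<Rightarrow> complex \<Rightarrow> complex \<Rightarrow> complex" where
  "frobenius_euler n j x \<mu> = fact j * fps_nth (frobenius_euler_fps n x \<mu>) j"

lemma frobenius_euler_generating_function: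
  "Abs_fps (\<lambda>j. frobenius_euler n j x \<mu> / fact j) = frobenius_euler_fps n x \<mu>"
  by (rule fps_ext) (simp add: frobenius_euler_def)

lemma frobenius_euler_fps_base:
  fixes \<mu> :: complex
  assumes "\<mu> \<noteq> 1"
  shows "(fps_const (1 - \<mu>) / (fps_exp 1 - fps_const \<mu>)) * (fps_exp 1 - fps_const \<mu>)
           = fps_const (1 - \<mu>)"
proof -
  have "is_unit (fps_exp 1 - fps_const \<mu>)"
    using assms by (simp add: fps_is_unit_iff)
  then show ?thesis
    by (rule unit_div_mult_self)
qed

definition multinomial :: "nat \<Rightarrow> nat \<Rightarrow> (nat \<Rightarrow> nat) \<Rightarrow> complex" where
  "multinomial n m v = fact n / (\<Prod>i\<in>{1..m}. fact (v i))"

(* Tuples (v_1, ..., v_m) are represented by extensional functions on {1..m}. *)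
definition multiple_power_sum :: "nat \<Rightarrow> nat \<Rightarrow> nat \<Rightarrow> complex \<Rightarrow> complex" where
  "multiple_power_sum n k m l =
     (\<Sum>v | v \<in> {1..m} \<rightarrow>\<^sub>E {0..n} \<and> (\<Sum>i\<in>{1..m}. v i) = n.
        multinomial n m v * l powi (- int (\<Sum>i\<in>{1..m}. i * v i))
          * of_nat (\<Sum>i\<in>{1..m}. i * v i) ^ k)"

end

theory Submission
  imports Defs
begin

text \<open>
  With \<open>P = (\<Sum>i=1..m. l\<^sup>-\<^sup>i e\<^sup>i\<^sup>t)\<close>, summing the geometric series gives
  \<open>l\<^sup>m P (e\<^sup>t - l) = e\<^sup>t (e\<^sup>m\<^sup>t - l\<^sup>m)\<close>. Hence the generating function of the Frobenius--Euler
  polynomials with parameter \<open>l\<close> is, up to the constant factor of the theorem, \<open>P\<^sup>n e\<^sup>-\<^sup>n\<^sup>t\<close> times the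
  one with parameter \<open>l\<^sup>m\<close> and argument \<open>x / m\<close>, taken at \<open>m t\<close>. By the multinomial theorem \<open>P\<^sup>n\<close>
  is the exponential generating function of the multiple power sums, and comparing the
  coefficients of any power of \<open>t\<close>, not only of \<open>t\<^sup>n\<^sup>-\<^sup>1\<close>, gives the identity.
\<close>

subsection \<open>The multinomial theorem\<close>

text \<open>Makes the natural-number quotients \<open>fact n div ...\<close> below exact, so that
  they are genuine multinomial coefficients.\<close>

lemma prod_fact_dvd_fact_sum:
  fixes v :: "'a \<Rightarrow> nat"
  assumes "finite A"
  shows "(\<Prod>i\<in>A. fact (v i)) dvd (fact (\<Sum>i\<in>A. v i) :: nat)"
  using assms
proof induction
  case empty
  then show ?case by simp
next
  case (insert x A)
  have "fact (v x) * (\<Prod>i\<in>A. fact (v i)) dvd (fact (v x) * fact (\<Sum>i\<in>A. v i) :: nat)"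
    using insert.IH by (rule mult_dvd_mono[OF dvd_refl])
  also have "\<dots> dvd fact (v x + (\<Sum>i\<in>A. v i))"
    by (rule fact_fact_dvd_fact)
  finally show ?case
    using insert.hyps by simp
qed

text \<open>Recursion for multinomial coefficients: \<open>k\<close> is the entry split off,
  \<open>p\<close> stands for the product of the factorials of the other entries.\<close>

lemma fact_div_fact_mult:
  fixes p k n :: nat
  assumes "k \<le> n" and "p dvd fact (n - k)" and "p > 0"
  shows "fact n div (fact k * p) = (n choose k) * (fact (n - k) div p)"
proof -
  obtain q where q: "fact (n - k) = p * q"
    using assms(2) by (elim dvdE)
  have "fact n = (fact k * p) * ((n choose k) * q)"
    using binomial_fact_lemma[OF assms(1)] q by (simp add: mult_ac)
  then show ?thesis
    using q assms(3) by simp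
qed

lemma finite_PiE_sum_eq:
  fixes n :: nat
  assumes "finite A"
  shows "finite {v \<in> A \<rightarrow>\<^sub>E UNIV. (\<Sum>i\<in>A. v i) = n}"
proof (rule finite_subset)
  show "{v \<in> A \<rightarrow>\<^sub>E UNIV. (\<Sum>i\<in>A. v i) = n} \<subseteq> A \<rightarrow>\<^sub>E {0..n}"
    using assms by (auto simp: PiE_iff extensional_def intro: member_le_sum)
qed (use assms in \<open>auto intro: finite_PiE\<close>)

text \<open>Induction on the index set: the binomial theorem splits off one summand, and its
  exponent becomes the new entry of the tuple. The integer quotient as coefficient lets the identity
  be used directly for power series.\<close>

theorem multinomial_theorem:
  fixes f :: "'a \<Rightarrow> 'b::comm_semiring_1"
  assumes "finite A"
  shows "(\<Sum>i\<in>A. f i) ^ n =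
    (\<Sum>v | v \<in> A \<rightarrow>\<^sub>E UNIV \<and> (\<Sum>i\<in>A. v i) = n.
       of_nat (fact n div (\<Prod>i\<in>A. fact (v i))) * (\<Prod>i\<in>A. f i ^ v i))"
  using assms
proof (induction A arbitrary: n)
  case empty
  have "{v. v = (\<lambda>x. undefined) \<and> 0 = n} = (if n = 0 then {\<lambda>x::'a. undefined::nat} else {})"
    by auto
  then show ?case
    by (simp add: power_0_left)
next
  case (insert x A)
  define V where "V B n = {v. v \<in> B \<rightarrow>\<^sub>E UNIV \<and> (\<Sum>i\<in>B. v i) = n}" for B :: "'a set" and n :: nat
  define h where "h B n v = of_nat (fact n div (\<Prod>i\<in>B. fact (v i))) * (\<Prod>i\<in>B. f i ^ v i)"
    for B n and v :: "'a \<Rightarrow> nat"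
  have fin: "finite (V A n)" for n
    unfolding V_def using finite_PiE_sum_eq[OF insert.hyps(1)] by simp
  have upd_sum: "(\<Sum>i\<in>A. (g(x := k)) i) = (\<Sum>i\<in>A. g i)" for g :: "'a \<Rightarrow> nat" and k
    using insert.hyps by (intro sum.cong) auto
  have upd_fact: "(\<Prod>i\<in>A. fact ((g(x := k)) i)) = (\<Prod>i\<in>A. fact (g i) :: nat)"
    for g :: "'a \<Rightarrow> nat" and k
    using insert.hyps by (intro prod.cong) auto
  have upd_pow: "(\<Prod>i\<in>A. f i ^ (g(x := k)) i) = (\<Prod>i\<in>A. f i ^ g i)" for g :: "'a \<Rightarrow> nat" and k
    using insert.hyps by (intro prod.cong) auto
  have step: "h (insert x A) n (g(x := k)) = of_nat (n choose k) * f x ^ k * h A (n - k) g"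
    if "k \<le> n" and "g \<in> V A (n - k)" for k g
  proof -
    have "(\<Prod>i\<in>A. fact (g i)) dvd (fact (n - k) :: nat)"
      using prod_fact_dvd_fact_sum[OF insert.hyps(1), of g] that(2) by (simp add: V_def)
    then have "fact n div (fact k * (\<Prod>i\<in>A. fact (g i))) =
        (n choose k) * (fact (n - k) div (\<Prod>i\<in>A. fact (g i)))"
      by (intro fact_div_fact_mult) (use that(1) in \<open>auto intro: prod_pos\<close>)
    then show ?thesis
      unfolding h_def using insert.hyps
      by (simp add: upd_fact upd_pow mult_ac del: fun_upd_apply) (simp add: mult_ac)
  qed
  have "(\<Sum>i\<in>insert x A. f i) ^ n = (f x + (\<Sum>i\<in>A. f i)) ^ n"
    using insert.hyps by simp
  also have "\<dots> = (\<Sum>k\<le>n. of_nat (n choose k) * f x ^ k * (\<Sum>v\<in>V A (n - k). h A (n - k) v))"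
    unfolding binomial_ring V_def h_def insert.IH ..
  also have "\<dots> = (\<Sum>k\<le>n. \<Sum>g\<in>V A (n - k). h (insert x A) n (g(x := k)))"
    by (simp add: sum_distrib_left step)
  also have "\<dots> = (\<Sum>(k, g)\<in>Sigma {..n} (\<lambda>k. V A (n - k)). h (insert x A) n (g(x := k)))"
    by (intro sum.Sigma) (auto simp: fin)
  \<comment> \<open>As \<open>x\<close> lies outside \<open>A\<close>, extensionality forces
    \<open>g x = undefined\<close>; resetting \<open>x\<close> to \<open>undefined\<close> therefore
    inverts the update.\<close>
  also have "\<dots> = (\<Sum>v\<in>V (insert x A) n. h (insert x A) n v)"
  proof (rule sum.reindex_bij_witness[where i = "\<lambda>v. (v x, v(x := undefined))"
        and j = "\<lambda>(k, g). g(x := k)"])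
    fix a assume "a \<in> Sigma {..n} (\<lambda>k. V A (n - k))"
    then obtain k g where a: "a = (k, g)" "k \<le> n" "g \<in> V A (n - k)"
      by auto
    then have "g x = undefined"
      using insert.hyps by (auto simp: V_def PiE_def extensional_def)
    then show "(case a of (k, g) \<Rightarrow> g(x := k)) \<in> V (insert x A) n"
      and "((case a of (k, g) \<Rightarrow> g(x := k)) x,
            (case a of (k, g) \<Rightarrow> g(x := k))(x := undefined)) = a"
      using a insert.hyps upd_sum[of g k]
      by (auto simp: V_def PiE_def extensional_def)
  next
    fix v assume v: "v \<in> V (insert x A) n"
    then show "(v x, v(x := undefined)) \<in> Sigma {..n} (\<lambda>k. V A (n - k))"
      using insert.hyps upd_sum[of v undefined]
      by (auto simp: V_def PiE_def extensional_def)
  qed auto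
  finally show ?case
    by (simp add: V_def h_def)
qed

subsection \<open>Generating functions\<close>

lemma multinomial_eq_of_nat:
  assumes "(\<Sum>i\<in>{1..m}. v i) = n"
  shows "multinomial n m v = of_nat (fact n div (\<Prod>i\<in>{1..m}. fact (v i)))"
proof -
  have "(\<Prod>i\<in>{1..m}. fact (v i)) dvd (fact n :: nat)"
    using prod_fact_dvd_fact_sum[of "{1..m}" v] assms by simp
  then obtain q where q: "(fact n :: nat) = (\<Prod>i\<in>{1..m}. fact (v i)) * q"
    by (elim dvdE)
  have pos: "(\<Prod>i\<in>{1..m}. fact (v i)) > (0::nat)"
    by (intro prod_pos) simp
  have "(fact n :: complex) = (\<Prod>i\<in>{1..m}. fact (v i)) * of_nat q"
    using arg_cong[OF q, of "of_nat :: nat \<Rightarrow> complex"] by simp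
  then show ?thesis
    unfolding multinomial_def q using pos by simp
qed

lemma fps_exp_sum:
  fixes f :: "'a \<Rightarrow> 'b::field_char_0"
  shows "fps_exp (\<Sum>i\<in>A. f i) = (\<Prod>i\<in>A. fps_exp (f i))"
  by (induction A rule: infinite_finite_induct) (simp_all add: fps_exp_add_mult)

section \<open>Geometric sums of exponentials\<close>

definition exp_geometric_sum :: "nat \<Rightarrow> complex \<Rightarrow> complex fps" where
  "exp_geometric_sum m l = (\<Sum>i=1..m. fps_const (inverse l ^ i) * fps_exp (of_nat i))"

text \<open>In the multinomial expansion a tuple \<open>v\<close> of weight w = \<open>?w v\<close>
  contributes a multiple of e^(wt), whose coefficient at t^k is w^k / k!.\<close>

lemma exp_geometric_sum_power_nth:
  "fps_nth (exp_geometric_sum m l ^ n) k = multiple_power_sum n k m l / fact k"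
proof -
  let ?V = "{v. v \<in> {1..m} \<rightarrow>\<^sub>E UNIV \<and> (\<Sum>i\<in>{1..m}. v i) = n}"
  let ?w = "\<lambda>v. \<Sum>i\<in>{1..m}. i * v i"
  \<comment> \<open>Natural numbers with sum \<open>n\<close> are each at most \<open>n\<close>, so
    the bound in \<open>multiple_power_sum\<close> is automatic.\<close>
  have V: "?V = {v. v \<in> {1..m} \<rightarrow>\<^sub>E {0..n} \<and> (\<Sum>i\<in>{1..m}. v i) = n}"
    by (auto simp: PiE_iff intro!: member_le_sum)
  have monomial: "(\<Prod>i\<in>{1..m}. (fps_const (inverse l ^ i) * fps_exp (of_nat i)) ^ v i) =
      fps_const (l powi (- int (?w v))) * fps_exp (of_nat (?w v))" for v
  proof -
    have "(\<Prod>i\<in>{1..m}. (fps_const (inverse l ^ i) * fps_exp (of_nat i)) ^ v i) =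
        (\<Prod>i\<in>{1..m}. fps_const (inverse l) ^ (i * v i)) *
        (\<Prod>i\<in>{1..m}. fps_exp (of_nat (i * v i)))"
      unfolding prod.distrib[symmetric]
      by (intro prod.cong refl)
        (simp add: power_mult_distrib fps_exp_power_mult fps_const_power power_mult mult.commute)
    also have "\<dots> = fps_const (inverse l ^ ?w v) * fps_exp (of_nat (?w v))"
      unfolding fps_const_power[symmetric] by (simp only: fps_exp_sum of_nat_sum power_sum)
    also have "inverse l ^ ?w v = l powi (- int (?w v))"
      by (simp only: power_int_minus power_int_of_nat power_inverse)
    finally show ?thesis .
  qed
  have "exp_geometric_sum m l ^ n =
      (\<Sum>v\<in>?V. of_nat (fact n div (\<Prod>i\<in>{1..m}. fact (v i))) *
        (fps_const (l powi (- int (?w v))) * fps_exp (of_nat (?w v))))"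
    unfolding exp_geometric_sum_def
    by (subst multinomial_theorem) (simp_all only: monomial finite_atLeastAtMost)
  also have "\<dots> = (\<Sum>v\<in>?V. fps_const (multinomial n m v * l powi (- int (?w v))) *
      fps_exp (of_nat (?w v)))"
    by (intro sum.cong refl)
      (simp add: multinomial_eq_of_nat fps_of_nat[symmetric] mult.assoc[symmetric] del: of_nat_sum)
  finally show ?thesis
    unfolding multiple_power_sum_def V[symmetric]
    by (simp add: fps_sum_nth sum_divide_distrib del: of_nat_sum)
qed

text \<open>In the induction step the old sum yields l e^((m+1)t) and the new term yields its
  negative; these cancel.\<close>

lemma exp_geometric_sum_telescope:
  assumes "l \<noteq> 0"
  shows "fps_const (l ^ m) * exp_geometric_sum m l * (fps_exp 1 - fps_const l) =
    fps_exp 1 * (fps_exp (of_nat m) - fps_const (l ^ m))"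
proof (induction m)
  case 0
  then show ?case
    by (simp add: exp_geometric_sum_def)
next
  case (Suc m)
  let ?E = "fps_exp 1 - fps_const l"
  have inv: "fps_const (l ^ Suc m) * fps_const (inverse l ^ Suc m) = 1"
    using assms by (simp add: fps_const_mult[symmetric] power_inverse del: power_Suc)
  have exp_Suc: "fps_exp (of_nat (Suc m)) = fps_exp 1 * (fps_exp (of_nat m) :: complex fps)"
    by (simp add: fps_exp_add_mult)
  have "fps_const (l ^ Suc m) * exp_geometric_sum (Suc m) l * ?E =
      fps_const l * (fps_const (l ^ m) * exp_geometric_sum m l * ?E) +
      (fps_const (l ^ Suc m) * fps_const (inverse l ^ Suc m)) * fps_exp (of_nat (Suc m)) * ?E"
    by (simp add: exp_geometric_sum_def algebra_simps fps_const_mult[symmetric] del: fps_const_mult)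
  also have "\<dots> = fps_exp 1 * (fps_exp (of_nat (Suc m)) - fps_const (l ^ Suc m))"
    unfolding Suc.IH inv exp_Suc
    by (simp add: algebra_simps fps_const_mult[symmetric] del: fps_const_mult)
  finally show ?case .
qed

section \<open>Dilation of the Frobenius-Euler generating function\<close>

text \<open>Denominator-free form of the generating function, which can be composed with mt without
  handling a quotient.\<close>

lemma frobenius_euler_fps_mult_denominator:
  assumes "\<mu> \<noteq> 1"
  shows "frobenius_euler_fps n x \<mu> * (fps_exp 1 - fps_const \<mu>) ^ n =
    fps_const ((1 - \<mu>) ^ n) * fps_exp x"
proof -
  have "frobenius_euler_fps n x \<mu> * (fps_exp 1 - fps_const \<mu>) ^ n =
      ((fps_const (1 - \<mu>) / (fps_exp 1 - fps_const \<mu>)) * (fps_exp 1 - fps_const \<mu>)) ^ n * fps_exp x"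
    by (simp only: frobenius_euler_fps_def power_mult_distrib mult_ac)
  then show ?thesis
    by (simp only: frobenius_euler_fps_base[OF assms] fps_const_power)
qed

text \<open>Both sides agree after multiplication by (e^t - l)^n, which can be cancelled in the
  integral domain of power series.\<close>

lemma frobenius_euler_fps_dilation:
  assumes "m \<ge> 1" and "l \<noteq> 0" and "l ^ m \<noteq> 1"
  shows "frobenius_euler_fps n x l =
    fps_const (((1 - l) / (1 - l ^ m)) ^ n * l ^ (m * n)) *
    ((exp_geometric_sum m l ^ n * fps_exp (- of_nat n)) *
     (frobenius_euler_fps n (x / of_nat m) (l ^ m) oo (fps_const (of_nat m) * fps_X)))"
    (is "?F = ?R")
proof -
  let ?E = "fps_exp 1 - fps_const l"
  let ?Em = "fps_exp (of_nat m) - fps_const (l ^ m)"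
  let ?P = "exp_geometric_sum m l"
  let ?X = "fps_const (of_nat m :: complex) * fps_X"
  let ?G = "frobenius_euler_fps n (x / of_nat m) (l ^ m) oo ?X"
  have "l \<noteq> 1"
    using assms(3) by auto
  \<comment> \<open>The denominator-free identity for l^m is composed with mt, which turns e^t into
    e^(mt) and e^(xt/m) into e^(xt).\<close>
  have G: "?G * ?Em ^ n = fps_const ((1 - l ^ m) ^ n) * fps_exp x"
  proof -
    have "(frobenius_euler_fps n (x / of_nat m) (l ^ m) * (fps_exp 1 - fps_const (l ^ m)) ^ n) oo ?X =
        ?G * ?Em ^ n"
      by (simp add: fps_compose_mult_distrib fps_compose_power[symmetric] fps_compose_sub_distrib
          del: fps_const_power)
    then show ?thesis
      using assms(1) unfolding frobenius_euler_fps_mult_denominator[OF assms(3)]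
      by (simp add: fps_compose_mult_distrib del: fps_const_power)
  qed
  \<comment> \<open>The factor e^(-nt) absorbs the e^(nt) left by the \<open>n\<close>-th power of
    the telescoped product.\<close>
  have cancel: "fps_exp 1 ^ n * fps_exp (- of_nat n) = (1 :: complex fps)"
    by (simp add: fps_exp_power_mult fps_exp_add_mult[symmetric])
  have "?R * ?E ^ n = fps_const (((1 - l) / (1 - l ^ m)) ^ n) *
      ((fps_const (l ^ m) * ?P * ?E) ^ n * fps_exp (- of_nat n) * ?G)"
    by (simp add: power_mult_distrib power_mult fps_const_mult[symmetric] fps_const_power[symmetric]
        mult_ac del: fps_const_mult fps_const_power)
  also have "\<dots> = fps_const (((1 - l) / (1 - l ^ m)) ^ n) *
      ((fps_exp 1 ^ n * fps_exp (- of_nat n)) * (?G * ?Em ^ n))"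
    unfolding exp_geometric_sum_telescope[OF assms(2)] by (simp only: power_mult_distrib mult_ac)
  also have "\<dots> = fps_const (((1 - l) / (1 - l ^ m)) ^ n * (1 - l ^ m) ^ n) * fps_exp x"
    unfolding cancel G by (simp add: mult.assoc[symmetric])
  also have "((1 - l) / (1 - l ^ m)) ^ n * (1 - l ^ m) ^ n = (1 - l) ^ n"
    using assms(3) by (simp add: power_mult_distrib[symmetric])
  also have "fps_const ((1 - l) ^ n) * fps_exp x = ?F * ?E ^ n"
    using frobenius_euler_fps_mult_denominator[OF \<open>l \<noteq> 1\<close>] by simp
  finally have "?R * ?E ^ n = ?F * ?E ^ n" .
  \<comment> \<open>The constant term is 1 - l.\<close>
  moreover have "fps_nth ?E 0 \<noteq> 0"
    using \<open>l \<noteq> 1\<close> by simp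
  then have "?E ^ n \<noteq> 0"
    by (metis fps_zero_nth power_not_zero)
  ultimately show ?thesis
    by simp
qed

section \<open>Comparison of coefficients\<close>

text \<open>Products of exponential generating functions correspond to binomial
  convolutions.\<close>

lemma fact_mult_fps_nth_mult:
  fixes f g :: "'a::field_char_0 fps"
  shows "fact N * fps_nth (f * g) N =
    (\<Sum>s=0..N. of_nat (N choose s) * (fact s * fps_nth f s) * (fact (N - s) * fps_nth g (N - s)))"
  by (simp add: fps_mult_nth sum_distrib_left binomial_fact)

lemma frobenius_euler_multiplication:
  assumes "m \<ge> 1" and "l \<noteq> 0" and "l ^ m \<noteq> 1"
  shows "frobenius_euler n N x l =
    ((1 - l) / (1 - l ^ m)) ^ n * l ^ (m * n) *
      (\<Sum>s = 0..N. \<Sum>k = 0..s.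
         of_nat (s choose k) * of_nat (N choose s) * (- of_nat n) ^ (s - k)
           * of_nat m ^ (N - s) * multiple_power_sum n k m l
           * frobenius_euler n (N - s) (x / of_nat m) (l ^ m))"
proof -
  let ?c = "((1 - l) / (1 - l ^ m)) ^ n * l ^ (m * n)"
  let ?Q = "exp_geometric_sum m l ^ n * fps_exp (- of_nat n)"
  let ?G = "frobenius_euler_fps n (x / of_nat m) (l ^ m) oo (fps_const (of_nat m) * fps_X)"
  \<comment> \<open>This convolution is the inner sum; the powers of -n are the coefficients of
    e^(-nt).\<close>
  have Q: "fact s * fps_nth ?Q s =
      (\<Sum>k=0..s. of_nat (s choose k) * multiple_power_sum n k m l * (- of_nat n) ^ (s - k))" for s
    unfolding fact_mult_fps_nth_mult by (simp add: exp_geometric_sum_power_nth)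
  \<comment> \<open>Substituting mt scales the coefficient at t^j by m^j.\<close>
  have G: "fact j * fps_nth ?G j = of_nat m ^ j * frobenius_euler n j (x / of_nat m) (l ^ m)" for j
    by (simp add: frobenius_euler_def)
  have "frobenius_euler n N x l = ?c * (fact N * fps_nth (?Q * ?G) N)"
    unfolding frobenius_euler_def frobenius_euler_fps_dilation[OF assms] fps_mult_left_const_nth
    by (simp only: mult_ac)
  also have "fact N * fps_nth (?Q * ?G) N =
      (\<Sum>s=0..N. of_nat (N choose s) *
        (\<Sum>k=0..s. of_nat (s choose k) * multiple_power_sum n k m l * (- of_nat n) ^ (s - k)) *
        (of_nat m ^ (N - s) * frobenius_euler n (N - s) (x / of_nat m) (l ^ m)))"
    unfolding fact_mult_fps_nth_mult[of N ?Q ?G] Q G ..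
  finally show ?thesis
    by (simp only: sum_distrib_left sum_distrib_right mult_ac)
qed

theorem theorem5:
  fixes m n :: nat and x l :: complex
  assumes "m \<ge> 1" and "n \<ge> 1" and "l \<noteq> 0" and "l ^ m \<noteq> 1"
  shows "frobenius_euler n (n - 1) x l =
    ((1 - l) / (1 - l ^ m)) ^ n * l ^ (m * n) *
      (\<Sum>s = 0..n - 1. \<Sum>k = 0..s.
         of_nat (s choose k) * of_nat ((n - 1) choose s) * (- of_nat n) ^ (s - k)
           * of_nat m ^ (n - 1 - s) * multiple_power_sum n k m l
           * frobenius_euler n (n - 1 - s) (x / of_nat m) (l ^ m))"
  using assms(1,3,4) by (rule frobenius_euler_multiplication)

end
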